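(* Suppose that all base stock levels satisfy $b_1=\cdots=b_J=1$. Then the strictly positive measure $\widetilde{\theta}=(\widetilde{\theta}(\mathbf{k}):\mathbf{k}\in K)$ of the inventory-replenishment subsystem, i.e. the strictly positive solution (unique up to a multiplicative constant) of $\widetilde{\theta}\cdot\mathbf{Q}_{red}=\mathbf{0}$, is given, up to a multiplicative constant, by $$\widetilde{\theta}(k_1,k_2,\dots,k_J,k_{J+1})=\left(\prod_{\ell=0}^{(\sum_{j\in\overline{J}}k_j)-1}\frac{1}{J-\ell}\right)\cdot\left(\prod_{j\in\overline{J}}\left(\frac{1}{\lambda_j}\right)^{k_j}\right)\cdot\left(\frac{1}{\nu}\right)^{k_{J+1}},\qquad \mathbf{k}=(k_1,\dots,k_{J+1})\in K.$$
   Context: Let $J>1$ be an integer, $\overline{J}=\{1,\dots,J\}$, with parameters $\lambda_j>0$ (arrival rates), $b_j\in\{1,2,\dots\}$ (base stock levels), $j\in\overline{J}$, and $\nu>0$ (supplier rate). $\mathbb{N}_0=\{0,1,2,\dots\}$; $\mathbf{e}_i$ is the $i$-th unit vector of $\mathbb{R}^{J+1}$; $1_{\{\cdot\}}$ is the indicator; empty products are $1$ and empty sums are $0$. Let $$K=\Big\{(k_1,\dots,k_J,k_{J+1})\in\mathbb{N}_0^{J+1}: 0\le k_j\le b_j,\ j=1,\dots,J,\ k_{J+1}=\sum_{j=1}^J (b_j-k_j)\Big\}.$$ Routing probabilities (strict priorities): for $\mathbf{k}\in K$ let $A(\mathbf{k})=\arg\max_{i\in\overline{J}}(b_i-k_i)$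 (the set of all maximizers), and $p_j(\mathbf{k})=1/|A(\mathbf{k})|$ if $j\in A(\mathbf{k})$, $p_j(\mathbf{k})=0$ otherwise. The reduced generator $\mathbf{Q}_{red}=(q_{red}(\mathbf{k};\widetilde{\mathbf{k}}))_{\mathbf{k},\widetilde{\mathbf{k}}\in K}$ of the inventory-replenishment subsystem has the rates, for $\mathbf{k}\in K$ and $i\in\overline{J}$, $$q_{red}(\mathbf{k};\mathbf{k}-\mathbf{e}_i+\mathbf{e}_{J+1})=\lambda_i 1_{\{k_i>0\}},\qquad q_{red}(\mathbf{k};\mathbf{k}+\mathbf{e}_i-\mathbf{e}_{J+1})=\nu\, p_i(\mathbf{k})1_{\{k_i<b_i\}},$$ all other off-diagonal rates are $0$, and diagonal entries are such that rows sum to $0$. *)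

theory Defs
  imports Complex_Main "HOL-Library.FuncSet"
begin

(* A state (k_1, ..., k_J, k_{J+1}) is a function on the index set {1..Suc J}, in the sense
   of FuncSet: it is extensional, so vectors are equal iff their J+1 entries agree.
   The nat subtractions b j - k j below are exact on state_space, since k j <= b j there. *)

definition state_space :: "nat \<Rightarrow> (nat \<Rightarrow> nat) \<Rightarrow> (nat \<Rightarrow> nat) set" where
  "state_space J b =
     {k \<in> extensional {1..Suc J}.
        (\<forall>j\<in>{1..J}. k j \<le> b j) \<and> k (Suc J) = (\<Sum>j=1..J. b j - k j)}"

definition priority_set :: "nat \<Rightarrow> (nat \<Rightarrow> nat) \<Rightarrow> (nat \<Rightarrow> nat) \<Rightarrow> nat set" where
  "priority_set J b k = {i. is_arg_max (\<lambda>i. b i - k i) (\<lambda>i. i \<in> {1..J}) i}"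

definition routing_prob :: "nat \<Rightarrow> (nat \<Rightarrow> nat) \<Rightarrow> (nat \<Rightarrow> nat) \<Rightarrow> nat \<Rightarrow> real" where
  "routing_prob J b k j =
     (if j \<in> priority_set J b k then 1 / real (card (priority_set J b k)) else 0)"

(* k - e_i + e_{J+1} and k + e_i - e_{J+1}. The truncated subtractions are harmless: the first
   vector is only used with a nonzero rate if k i > 0, and the second only if k i < b i, which
   forces k (Suc J) > 0 on state_space. *)

definition demand_move :: "nat \<Rightarrow> nat \<Rightarrow> (nat \<Rightarrow> nat) \<Rightarrow> (nat \<Rightarrow> nat)" where
  "demand_move J i k = k(i := k i - 1, Suc J := k (Suc J) + 1)"

definition supply_move :: "nat \<Rightarrow> nat \<Rightarrow> (nat \<Rightarrow> nat) \<Rightarrow> (nat \<Rightarrow> nat)" where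
  "supply_move J i k = k(i := k i + 1, Suc J := k (Suc J) - 1)"

(* The transitions out of k with nonzero rate have pairwise distinct targets, so at most one
   summand is nonzero and the sum only selects the transition leading to k'. *)

definition offdiag_rate ::
  "nat \<Rightarrow> (nat \<Rightarrow> nat) \<Rightarrow> (nat \<Rightarrow> real) \<Rightarrow> real \<Rightarrow> (nat \<Rightarrow> nat) \<Rightarrow> (nat \<Rightarrow> nat) \<Rightarrow> real" where
  "offdiag_rate J b lam nu k k' =
     (\<Sum>i=1..J.
        (if k' = demand_move J i k then lam i * of_bool (k i > 0) else 0) +
        (if k' = supply_move J i k then nu * routing_prob J b k i * of_bool (k i < b i) else 0))"

definition q_red ::
  "nat \<Rightarrow> (nat \<Rightarrow> nat) \<Rightarrow> (nat \<Rightarrow> real) \<Rightarrow> real \<Rightarrow> (nat \<Rightarrow> nat) \<Rightarrow> (nat \<Rightarrow> nat) \<Rightarrow> real" where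
  "q_red J b lam nu k k' =
     (if k = k' then - (\<Sum>l\<in>state_space J b - {k}. offdiag_rate J b lam nu k l)
      else offdiag_rate J b lam nu k k')"

definition positive_stationary_measure :: "'s set \<Rightarrow> ('s \<Rightarrow> 's \<Rightarrow> real) \<Rightarrow> ('s \<Rightarrow> real) \<Rightarrow> bool" where
  "positive_stationary_measure S q \<theta> \<longleftrightarrow>
     (\<forall>k\<in>S. \<theta> k > 0) \<and> (\<forall>k'\<in>S. (\<Sum>k\<in>S. \<theta> k * q k k') = 0)"

lemma finite_state_space: "finite (state_space J b)"
proof (rule finite_subset)
  let ?N = "\<Sum>j=1..J. b j"
  show "finite ({1..Suc J} \<rightarrow>\<^sub>E {..?N})"
    by (intro finite_PiE) auto
  show "state_space J b \<subseteq> {1..Suc J} \<rightarrow>\<^sub>E {..?N}"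
  proof
    fix k assume k: "k \<in> state_space J b"
    have "k j \<le> ?N" if "j \<in> {1..Suc J}" for j
    proof (cases "j = Suc J")
      case True
      then show ?thesis using k by (auto simp: state_space_def intro: sum_mono)
    next
      case False
      with that have j: "j \<in> {1..J}" by auto
      then have "k j \<le> b j" using k by (auto simp: state_space_def)
      also have "b j \<le> ?N" using j by (intro member_le_sum) auto
      finally show ?thesis .
    qed
    then show "k \<in> {1..Suc J} \<rightarrow>\<^sub>E {..?N}"
      using k by (auto simp: state_space_def PiE_def)
  qed
qed

end

theory Submission
  imports Defs
begin

text \<open>
  The candidate measure satisfies the detailed balance equations. When all base stock levels
  are 1, a location holds either one item or none, so the locations of maximal deficit are
  exactly the empty ones, and there are as many of them as there are outstanding orders. The
  routing probability of every empty location is therefore the reciprocal of that number, and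
  filling location \<open>i\<close> multiplies the candidate by exactly the ratio of the supply rate into
  \<open>i\<close> and the demand rate \<open>lam i\<close> out of it (\<open>product_form_balance\<close>).

  Detailed balance also gives uniqueness. If \<open>\<theta> = h \<cdot> \<pi>\<close> with \<open>\<pi>\<close> reversible, the
  balance equations for \<open>\<theta>\<close> say that \<open>h\<close> is harmonic (\<open>reversible_balance_iff_harmonic\<close>). A
  harmonic function on a finite set takes its maximum and its minimum in every state that can be
  reached from all others (\<open>harmonic_const\<close>). Such a state is the one with full stock: as long
  as an order is outstanding, the supplier serves a location of maximal, hence positive, deficit
  (\<open>full_state_reachable\<close>).
\<close>

section \<open>Reversible generators on a finite set\<close>

text \<open>
  At a maximum \<open>x\<close> of \<open>h\<close>, the rates average the nonnegative differences \<open>h x - h y\<close> to 0, so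
  the maximum is also attained in all successors of \<open>x\<close>.
\<close>

lemma harmonic_max_at_root:
  fixes q :: "'s \<Rightarrow> 's \<Rightarrow> real" and h :: "'s \<Rightarrow> real"
  assumes fin: "finite S"
    and nonneg: "\<And>x y. x \<in> S \<Longrightarrow> y \<in> S \<Longrightarrow> x \<noteq> y \<Longrightarrow> q x y \<ge> 0"
    and rows: "\<And>x. x \<in> S \<Longrightarrow> (\<Sum>y\<in>S. q x y) = 0"
    and reach: "\<And>x. x \<in> S \<Longrightarrow> (x, r) \<in> {(x, y). x \<in> S \<and> y \<in> S \<and> q x y > 0}\<^sup>*"
    and harm: "\<And>x. x \<in> S \<Longrightarrow> (\<Sum>y\<in>S. q x y * h y) = 0"
    and z: "z \<in> S"
  shows "h z \<le> h r"
proof -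
  define M where "M = Max (h ` S)"
  have le: "h y \<le> M" if "y \<in> S" for y
    using that fin by (simp add: M_def)
  have "M \<in> h ` S" unfolding M_def using fin z by (intro Max_in) auto
  then obtain x where x: "x \<in> S" "h x = M" by auto
  have propagate: "h v = M" if u: "u \<in> S" "h u = M" and v: "v \<in> S" "q u v > 0" for u v
  proof -
    have "(\<Sum>y\<in>S. q u y * (M - h y)) = M * (\<Sum>y\<in>S. q u y) - (\<Sum>y\<in>S. q u y * h y)"
      by (simp add: sum_distrib_left sum_subtractf algebra_simps)
    then have "(\<Sum>y\<in>S. q u y * (M - h y)) = 0"
      using rows[OF u(1)] harm[OF u(1)] by simp
    moreover have "q u y * (M - h y) \<ge> 0" if "y \<in> S" for y
      using nonneg[OF u(1) that] le[OF that] u(2) by (cases "u = y") auto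
    ultimately have "q u v * (M - h v) = 0"
      using fin v(1) by (simp add: sum_nonneg_eq_0_iff)
    then show ?thesis using v(2) by simp
  qed
  from reach[OF x(1)] have "h r = M"
  proof (induction rule: rtrancl_induct)
    case base
    show ?case by (rule x(2))
  next
    case (step y w)
    then show ?case using propagate by blast
  qed
  then show ?thesis using le[OF z] by simp
qed

lemma harmonic_const:
  fixes q :: "'s \<Rightarrow> 's \<Rightarrow> real" and h :: "'s \<Rightarrow> real"
  assumes "finite S"
    and "\<And>x y. x \<in> S \<Longrightarrow> y \<in> S \<Longrightarrow> x \<noteq> y \<Longrightarrow> q x y \<ge> 0"
    and "\<And>x. x \<in> S \<Longrightarrow> (\<Sum>y\<in>S. q x y) = 0"
    and "\<And>x. x \<in> S \<Longrightarrow> (x, r) \<in> {(x, y). x \<in> S \<and> y \<in> S \<and> q x y > 0}\<^sup>*"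
    and harm: "\<And>x. x \<in> S \<Longrightarrow> (\<Sum>y\<in>S. q x y * h y) = 0"
    and z: "z \<in> S"
  shows "h z = h r"
proof (rule antisym)
  show "h z \<le> h r"
    by (rule harmonic_max_at_root[OF assms])
  have "(\<Sum>y\<in>S. q x y * - h y) = 0" if "x \<in> S" for x
    using harm[OF that] by (simp add: sum_negf)
  then have "- h z \<le> - h r"
    using harmonic_max_at_root[OF assms(1-4) _ z, where h = "\<lambda>y. - h y"] by blast
  then show "h r \<le> h z" by simp
qed

lemma reversible_balance_iff_harmonic:
  fixes q :: "'s \<Rightarrow> 's \<Rightarrow> real" and h \<pi> :: "'s \<Rightarrow> real"
  assumes db: "\<And>x y. x \<in> S \<Longrightarrow> y \<in> S \<Longrightarrow> \<pi> x * q x y = \<pi> y * q y x"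
    and x: "x \<in> S" and pos: "\<pi> x > 0"
  shows "(\<Sum>y\<in>S. (h y * \<pi> y) * q y x) = 0 \<longleftrightarrow> (\<Sum>y\<in>S. q x y * h y) = 0"
proof -
  have "(\<Sum>y\<in>S. (h y * \<pi> y) * q y x) = (\<Sum>y\<in>S. \<pi> x * (q x y * h y))"
    using db[OF _ x] by (intro sum.cong) (auto simp: mult_ac)
  also have "\<dots> = \<pi> x * (\<Sum>y\<in>S. q x y * h y)"
    by (simp add: sum_distrib_left)
  finally show ?thesis using pos by simp
qed

lemma positive_stationary_measure_reversible_iff:
  fixes q :: "'s \<Rightarrow> 's \<Rightarrow> real" and \<pi> \<theta> :: "'s \<Rightarrow> real"
  assumes fin: "finite S" and r: "r \<in> S"
    and nonneg: "\<And>x y. x \<in> S \<Longrightarrow> y \<in> S \<Longrightarrow> x \<noteq> y \<Longrightarrow> q x y \<ge> 0"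
    and rows: "\<And>x. x \<in> S \<Longrightarrow> (\<Sum>y\<in>S. q x y) = 0"
    and reach: "\<And>x. x \<in> S \<Longrightarrow> (x, r) \<in> {(x, y). x \<in> S \<and> y \<in> S \<and> q x y > 0}\<^sup>*"
    and pos: "\<And>x. x \<in> S \<Longrightarrow> \<pi> x > 0"
    and db: "\<And>x y. x \<in> S \<Longrightarrow> y \<in> S \<Longrightarrow> x \<noteq> y \<Longrightarrow> \<pi> x * q x y = \<pi> y * q y x"
  shows "positive_stationary_measure S q \<theta> \<longleftrightarrow> (\<exists>c>0. \<forall>x\<in>S. \<theta> x = c * \<pi> x)"
proof -
  have db': "\<pi> x * q x y = \<pi> y * q y x" if "x \<in> S" "y \<in> S" for x y
    using db[OF that] by (cases "x = y") auto
  note harmonic_iff = reversible_balance_iff_harmonic[where \<pi> = \<pi> and q = q and S = S, OF db' _ pos]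
  show ?thesis
  proof
    assume stat: "positive_stationary_measure S q \<theta>"
    define h where "h x = \<theta> x / \<pi> x" for x
    have \<theta>: "\<theta> x = h x * \<pi> x" if "x \<in> S" for x
      using pos[OF that] by (simp add: h_def)
    have "(\<Sum>y\<in>S. q x y * h y) = 0" if x: "x \<in> S" for x
    proof -
      have "(\<Sum>y\<in>S. (h y * \<pi> y) * q y x) = (\<Sum>y\<in>S. \<theta> y * q y x)"
        by (intro sum.cong) (auto simp: \<theta>)
      then show ?thesis
        using stat x harmonic_iff[OF _ _ x x, of h] by (simp add: positive_stationary_measure_def)
    qed
    then have "h x = h r" if "x \<in> S" for x
      using harmonic_const[OF fin nonneg rows reach _ that, of h] by blast
    moreover have "h r > 0"
      using stat r pos[OF r] by (simp add: h_def positive_stationary_measure_def)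
    ultimately show "\<exists>c>0. \<forall>x\<in>S. \<theta> x = c * \<pi> x"
      using \<theta> by metis
  next
    assume "\<exists>c>0. \<forall>x\<in>S. \<theta> x = c * \<pi> x"
    then obtain c where c: "c > 0" and \<theta>: "\<And>x. x \<in> S \<Longrightarrow> \<theta> x = c * \<pi> x" by blast
    have "(\<Sum>y\<in>S. \<theta> y * q y x) = 0" if x: "x \<in> S" for x
    proof -
      have "(\<Sum>y\<in>S. q x y * c) = 0"
        using rows[OF x] by (simp flip: sum_distrib_right)
      then have "(\<Sum>y\<in>S. (c * \<pi> y) * q y x) = 0"
        using harmonic_iff[OF _ _ x x, of "\<lambda>_. c"] by simp
      then show ?thesis by (simp add: \<theta> cong: sum.cong)
    qed
    then show "positive_stationary_measure S q \<theta>"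
      using c pos \<theta> by (simp add: positive_stationary_measure_def)
  qed
qed

section \<open>The transitions for arbitrary base stock levels\<close>

lemma q_red_row_sum:
  assumes "k \<in> state_space J b"
  shows "(\<Sum>l\<in>state_space J b. q_red J b lam nu k l) = 0"
proof -
  let ?S = "state_space J b"
  have "(\<Sum>l\<in>?S. q_red J b lam nu k l) =
      q_red J b lam nu k k + (\<Sum>l\<in>?S - {k}. q_red J b lam nu k l)"
    using assms by (simp add: sum.remove finite_state_space)
  also have "(\<Sum>l\<in>?S - {k}. q_red J b lam nu k l) = (\<Sum>l\<in>?S - {k}. offdiag_rate J b lam nu k l)"
    by (intro sum.cong) (auto simp: q_red_def)
  finally show ?thesis by (simp add: q_red_def)
qed

lemma routing_prob_nonneg: "routing_prob J b k i \<ge> 0"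
  by (simp add: routing_prob_def)

lemma offdiag_rate_nonneg:
  assumes "\<And>j. j \<in> {1..J} \<Longrightarrow> lam j > 0" and "nu > 0"
  shows "offdiag_rate J b lam nu k k' \<ge> 0"
  unfolding offdiag_rate_def
  using assms by (intro sum_nonneg) (auto simp: routing_prob_nonneg less_imp_le)

lemma pipeline_pos:
  assumes "k \<in> state_space J b" "i \<in> {1..J}" "k i < b i"
  shows "k (Suc J) > 0"
proof -
  have "b i - k i \<le> (\<Sum>j=1..J. b j - k j)"
    using assms(2) by (intro member_le_sum) auto
  then show ?thesis using assms by (simp add: state_space_def)
qed

text \<open>
  Both truncated subtractions are undone by the opposite move: the one in \<open>demand_move\<close> because
  of the side condition, and the one in \<open>supply_move\<close> because a free place at location \<open>i\<close> means
  that an order is outstanding.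
\<close>

lemma supply_demand_reverse:
  assumes k: "k \<in> state_space J b" and k': "k' \<in> state_space J b" and i: "i \<in> {1..J}"
  shows "k' = supply_move J i k \<and> k i < b i \<longleftrightarrow> k = demand_move J i k' \<and> k' i > 0"
proof
  assume A: "k' = supply_move J i k \<and> k i < b i"
  with pipeline_pos[OF k i] have "k (Suc J) > 0" by simp
  with A i show "k = demand_move J i k' \<and> k' i > 0"
    by (auto simp: supply_move_def demand_move_def fun_eq_iff)
next
  assume A: "k = demand_move J i k' \<and> k' i > 0"
  have "k' i \<le> b i" using k' i by (auto simp: state_space_def)
  with A i show "k' = supply_move J i k \<and> k i < b i"
    by (auto simp: supply_move_def demand_move_def fun_eq_iff)
qed

lemma supply_move_in_state_space:
  assumes k: "k \<in> state_space J b" and i: "i \<in> {1..J}" and less: "k i < b i"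
  shows "supply_move J i k \<in> state_space J b"
proof -
  let ?k' = "supply_move J i k"
  have "(\<Sum>j=1..J. b j - k j) = (b i - k i) + (\<Sum>j\<in>{1..J} - {i}. b j - k j)"
    using i by (simp add: sum.remove)
  also have "(\<Sum>j\<in>{1..J} - {i}. b j - k j) = (\<Sum>j\<in>{1..J} - {i}. b j - ?k' j)"
    by (intro sum.cong) (auto simp: supply_move_def)
  also have "b i - k i = Suc (b i - ?k' i)"
    using i less by (simp add: supply_move_def)
  finally have "(\<Sum>j=1..J. b j - k j) = Suc (\<Sum>j=1..J. b j - ?k' j)"
    using i by (simp add: sum.remove)
  moreover have "?k' (Suc J) = (\<Sum>j=1..J. b j - k j) - 1"
    using k by (simp add: supply_move_def state_space_def)
  ultimately have "?k' (Suc J) = (\<Sum>j=1..J. b j - ?k' j)" by simp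
  moreover have "?k' \<in> extensional {1..Suc J}" "\<forall>j\<in>{1..J}. ?k' j \<le> b j"
    using k i less by (auto simp: state_space_def supply_move_def extensional_def)
  ultimately show ?thesis by (simp add: state_space_def)
qed

definition full_state :: "nat \<Rightarrow> (nat \<Rightarrow> nat) \<Rightarrow> nat \<Rightarrow> nat" where
  "full_state J b = restrict (b(Suc J := 0)) {1..Suc J}"

lemma full_state_in_state_space: "full_state J b \<in> state_space J b"
  by (auto simp: full_state_def state_space_def)

lemma eq_full_state:
  assumes "k \<in> state_space J b" "k (Suc J) = 0"
  shows "k = full_state J b"
proof
  fix j
  have "\<forall>j\<in>{1..J}. k j = b j"
    using assms by (auto simp: state_space_def intro: antisym)
  then show "k j = full_state J b j"
    using assms by (cases "j \<in> {1..J}"; cases "j = Suc J")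
      (auto simp: full_state_def state_space_def extensional_def)
qed

lemma priority_supply_rate_pos:
  assumes k: "k \<in> state_space J b" and order: "k (Suc J) > 0"
    and lam: "\<And>j. j \<in> {1..J} \<Longrightarrow> lam j > 0" and nu: "nu > 0"
  obtains i where "i \<in> {1..J}" "k i < b i" "offdiag_rate J b lam nu k (supply_move J i k) > 0"
proof -
  have "\<exists>j\<in>{1..J}. b j - k j \<noteq> 0"
  proof (rule ccontr)
    assume "\<not> ?thesis"
    then have "(\<Sum>j=1..J. b j - k j) = 0" by (intro sum.neutral) blast
    with order k show False by (simp add: state_space_def)
  qed
  then obtain j where j: "j \<in> {1..J}" "b j - k j \<noteq> 0" by blast
  have "Max ((\<lambda>j. b j - k j) ` {1..J}) \<in> (\<lambda>j. b j - k j) ` {1..J}"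
    using j by (intro Max_in) auto
  then obtain i where i: "i \<in> {1..J}" and Max: "Max ((\<lambda>j. b j - k j) ` {1..J}) = b i - k i"
    by (rule imageE)
  have max: "b l - k l \<le> b i - k i" if "l \<in> {1..J}" for l
    unfolding Max[symmetric] using that by (intro Max_ge) auto
  have prio: "i \<in> priority_set J b k"
    using i max by (auto simp: priority_set_def is_arg_max_def not_less)
  have less: "k i < b i" using max[OF j(1)] j(2) by linarith
  have "priority_set J b k \<subseteq> {1..J}"
    by (auto simp: priority_set_def is_arg_max_def)
  then have "finite (priority_set J b k)" by (rule finite_subset) simp
  with prio have "routing_prob J b k i > 0"
    by (auto simp: routing_prob_def card_gt_0_iff)
  then have pos: "nu * routing_prob J b k i * of_bool (k i < b i) > 0"
    using nu less by simp
  let ?k' = "supply_move J i k"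
  let ?D = "\<lambda>l. if ?k' = demand_move J l k then lam l * of_bool (k l > 0) else 0"
  let ?U = "\<lambda>l. if ?k' = supply_move J l k
    then nu * routing_prob J b k l * of_bool (k l < b l) else 0"
  have D: "?D l \<ge> 0" if "l \<in> {1..J}" for l
    using lam[OF that] by simp
  have U: "?U l \<ge> 0" for l
    using nu routing_prob_nonneg[of J b k l] by simp
  have "?D i + ?U i > 0"
    using D[OF i] pos by (intro add_nonneg_pos) simp_all
  then have "(\<Sum>l=1..J. ?D l + ?U l) > 0"
    using i D U by (intro sum_pos2[of _ i] add_nonneg_nonneg) simp_all
  then have "offdiag_rate J b lam nu k ?k' > 0"
    by (simp only: offdiag_rate_def)
  with i less that show ?thesis by blast
qed

text \<open>
  Serving a location of maximal deficit lowers the number of outstanding orders by one, so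
  the induction is on that number.
\<close>

lemma full_state_reachable:
  assumes "k \<in> state_space J b"
    and lam: "\<And>j. j \<in> {1..J} \<Longrightarrow> lam j > 0" and nu: "nu > 0"
  shows "(k, full_state J b) \<in>
    {(k, k'). k \<in> state_space J b \<and> k' \<in> state_space J b \<and> q_red J b lam nu k k' > 0}\<^sup>*"
    (is "_ \<in> ?R\<^sup>*")
  using assms(1)
proof (induction "k (Suc J)" arbitrary: k)
  case 0
  then show ?case using eq_full_state[of k J b] by simp
next
  case (Suc n)
  then have "k (Suc J) > 0" by simp
  then obtain i where i: "i \<in> {1..J}" "k i < b i"
      and rate: "offdiag_rate J b lam nu k (supply_move J i k) > 0"
    by (rule priority_supply_rate_pos[OF Suc.prems _ lam nu])
  let ?k' = "supply_move J i k"
  have k': "?k' \<in> state_space J b"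
    by (rule supply_move_in_state_space[OF Suc.prems i])
  have n: "n = ?k' (Suc J)"
    using Suc.hyps(2) by (simp add: supply_move_def)
  have "k \<noteq> ?k'"
    using Suc.hyps(2) n by (metis n_not_Suc_n)
  then have "(k, ?k') \<in> ?R"
    using Suc.prems k' rate by (simp add: q_red_def)
  with Suc.hyps(1)[OF n k'] show ?case by (rule converse_rtrancl_into_rtrancl[rotated])
qed

text \<open>
  The supply and demand terms of a single location balance each other across an edge, so
  detailed balance for the generator can be checked location by location.
\<close>

lemma q_red_detailed_balance:
  assumes k: "k \<in> state_space J b" and k': "k' \<in> state_space J b" and "k \<noteq> k'"
    and balance: "\<And>k i. k \<in> state_space J b \<Longrightarrow> i \<in> {1..J} \<Longrightarrow> k i < b i \<Longrightarrow>
      \<pi> k * (nu * routing_prob J b k i) = \<pi> (supply_move J i k) * lam i"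
  shows "\<pi> k * q_red J b lam nu k k' = \<pi> k' * q_red J b lam nu k' k"
proof -
  define D where
    "D i k k' = (if k' = demand_move J i k then lam i * of_bool (k i > 0) else 0)" for i k k'
  define U where
    "U i k k' = (if k' = supply_move J i k
      then nu * routing_prob J b k i * of_bool (k i < b i) else 0)" for i k k'
  have rate: "offdiag_rate J b lam nu k k' = (\<Sum>i=1..J. D i k k' + U i k k')" for k k'
    by (simp add: offdiag_rate_def D_def U_def)
  have edge: "\<pi> k * U i k k' = \<pi> k' * D i k' k"
    if "k \<in> state_space J b" "k' \<in> state_space J b" "i \<in> {1..J}" for i k k'
  proof (cases "k' = supply_move J i k \<and> k i < b i")
    case True
    with supply_demand_reverse[OF that] balance[OF that(1,3)] show ?thesis
      by (simp add: U_def D_def)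
  next
    case False
    with supply_demand_reverse[OF that] show ?thesis
      by (auto simp: U_def D_def)
  qed
  have "\<pi> k * offdiag_rate J b lam nu k k' = \<pi> k' * offdiag_rate J b lam nu k' k"
    unfolding rate sum_distrib_left
    using edge[OF k k'] edge[OF k' k] by (intro sum.cong) (auto simp: distrib_left)
  with \<open>k \<noteq> k'\<close> show ?thesis by (simp add: q_red_def)
qed

section \<open>Unit base stock levels\<close>

definition product_form :: "nat \<Rightarrow> (nat \<Rightarrow> real) \<Rightarrow> real \<Rightarrow> (nat \<Rightarrow> nat) \<Rightarrow> real" where
  "product_form J lam nu k =
     (\<Prod>l<(\<Sum>j=1..J. k j). 1 / (real J - real l)) *
     (\<Prod>j=1..J. (1 / lam j) ^ k j) *
     (1 / nu) ^ k (Suc J)"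

lemma unit_base_stock_pipeline:
  assumes "\<And>j. j \<in> {1..J} \<Longrightarrow> b j = 1" and "k \<in> state_space J b"
  shows "(\<Sum>j=1..J. k j) + k (Suc J) = J"
proof -
  have "(\<Sum>j=1..J. k j) + (\<Sum>j=1..J. b j - k j) = (\<Sum>j=1..J. k j + (b j - k j))"
    by (simp add: sum.distrib)
  also have "\<dots> = (\<Sum>j=1..J. 1)"
    using assms by (intro sum.cong) (auto simp: state_space_def)
  finally show ?thesis using assms(2) by (simp add: state_space_def)
qed

text \<open>
  Deficits are 0 or 1, so as soon as one location is empty the maximisers are exactly the empty
  locations, and the outstanding orders count them.
\<close>

lemma unit_base_stock_routing_prob:
  assumes b: "\<And>j. j \<in> {1..J} \<Longrightarrow> b j = 1" and k: "k \<in> state_space J b"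
    and i: "i \<in> {1..J}" "k i < b i"
  shows "routing_prob J b k i = 1 / real (k (Suc J))"
proof -
  have empty: "k i = 0" using i b by simp
  have prio: "priority_set J b k = {j \<in> {1..J}. k j = 0}"
  proof (intro set_eqI iffI)
    fix j assume "j \<in> priority_set J b k"
    then have "j \<in> {1..J}" "\<not> b i - k i > b j - k j"
      using i by (auto simp: priority_set_def is_arg_max_def)
    then show "j \<in> {j \<in> {1..J}. k j = 0}"
      using b[of j] b[of i] i empty by simp
  next
    fix j assume "j \<in> {j \<in> {1..J}. k j = 0}"
    then show "j \<in> priority_set J b k"
      using b by (auto simp: priority_set_def is_arg_max_def)
  qed
  have "k (Suc J) = (\<Sum>j=1..J. b j - k j)"
    using k by (simp add: state_space_def)
  also have "\<dots> = (\<Sum>j=1..J. if k j = 0 then 1 else 0)"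
    using k b by (intro sum.cong) (auto simp: state_space_def)
  also have "\<dots> = card {j \<in> {1..J}. k j = 0}"
    by (simp flip: sum.inter_filter)
  finally have "k (Suc J) = card (priority_set J b k)"
    by (simp add: prio)
  moreover have "i \<in> priority_set J b k"
    using i empty by (simp add: prio)
  ultimately show ?thesis by (simp add: routing_prob_def)
qed

lemma product_form_pos:
  assumes b: "\<And>j. j \<in> {1..J} \<Longrightarrow> b j = 1" and k: "k \<in> state_space J b"
    and lam: "\<And>j. j \<in> {1..J} \<Longrightarrow> lam j > 0" and nu: "nu > 0"
  shows "product_form J lam nu k > 0"
proof -
  have "(\<Sum>j=1..J. k j) \<le> J"
    using unit_base_stock_pipeline[OF b k] by simp
  then have "(\<Prod>l<(\<Sum>j=1..J. k j). 1 / (real J - real l)) > 0"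
    by (intro prod_pos) auto
  moreover have "(\<Prod>j=1..J. (1 / lam j) ^ k j) > 0"
    using lam by (intro prod_pos) auto
  ultimately show ?thesis
    using nu by (simp add: product_form_def)
qed

text \<open>
  Filling location \<open>i\<close> adds the factor \<open>1 / (J - n)\<close> to the first product, where \<open>n\<close> items are in
  stock, turns the factor 1 of location \<open>i\<close> into \<open>1 / lam i\<close>, and removes one factor \<open>1 / nu\<close>. As
  \<open>J - n\<close> orders are outstanding, \<open>1 / (J - n)\<close> is the routing probability, and the measure is
  multiplied by \<open>nu\<close> times that probability, divided by \<open>lam i\<close>.
\<close>

lemma product_form_balance:
  assumes b: "\<And>j. j \<in> {1..J} \<Longrightarrow> b j = 1" and k: "k \<in> state_space J b"
    and i: "i \<in> {1..J}" "k i < b i"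
    and lam: "\<And>j. j \<in> {1..J} \<Longrightarrow> lam j > 0" and nu: "nu > 0"
  shows "product_form J lam nu k * (nu * routing_prob J b k i) =
    product_form J lam nu (supply_move J i k) * lam i"
proof -
  let ?k' = "supply_move J i k" and ?n = "\<Sum>j=1..J. k j"
  obtain m where m: "k (Suc J) = Suc m"
    using pipeline_pos[OF k i] gr0_conv_Suc by blast
  have k'_eq: "?k' j = k j" if "j \<in> {1..J} - {i}" for j
    using that by (auto simp: supply_move_def)
  have k'_i: "?k' i = Suc (k i)" and k'_J: "?k' (Suc J) = m"
    using i m by (auto simp: supply_move_def)
  have "(\<Sum>j\<in>{1..J} - {i}. ?k' j) = (\<Sum>j\<in>{1..J} - {i}. k j)"
    by (intro sum.cong refl k'_eq)
  then have "(\<Sum>j=1..J. ?k' j) = Suc (k i) + (\<Sum>j\<in>{1..J} - {i}. k j)"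
    using i by (simp add: sum.remove k'_i)
  then have stock: "(\<Sum>j=1..J. ?k' j) = Suc ?n"
    using i by (simp add: sum.remove)
  have "(\<Prod>j\<in>{1..J} - {i}. (1 / lam j) ^ ?k' j) = (\<Prod>j\<in>{1..J} - {i}. (1 / lam j) ^ k j)"
    by (intro prod.cong refl) (simp only: k'_eq)
  then have "(\<Prod>j=1..J. (1 / lam j) ^ ?k' j) =
      (1 / lam i) ^ Suc (k i) * (\<Prod>j\<in>{1..J} - {i}. (1 / lam j) ^ k j)"
    using i by (simp add: prod.remove k'_i)
  also have "\<dots> = (1 / lam i) * (\<Prod>j=1..J. (1 / lam j) ^ k j)"
    using i by (simp add: prod.remove)
  finally have demand: "(\<Prod>j=1..J. (1 / lam j) ^ ?k' j) * lam i = (\<Prod>j=1..J. (1 / lam j) ^ k j)"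
    using lam[OF i(1)] by simp
  have prob: "routing_prob J b k i = 1 / (real J - real ?n)"
  proof -
    have "real (k (Suc J)) = real J - real ?n"
      using unit_base_stock_pipeline[OF b k] by (metis add_diff_cancel_left' of_nat_add)
    then show ?thesis
      by (simp only: unit_base_stock_routing_prob[OF b k i])
  qed
  have removed_order: "(1 / nu) ^ k (Suc J) * nu = (1 / nu) ^ m"
    using nu by (simp add: m)
  let ?P = "\<Prod>l<?n. 1 / (real J - real l)"
  let ?L = "\<Prod>j=1..J. (1 / lam j) ^ k j"
  have "product_form J lam nu k * (nu * routing_prob J b k i) =
      ?P * (1 / (real J - real ?n)) * ?L * ((1 / nu) ^ k (Suc J) * nu)"
    unfolding product_form_def prob by (simp only: mult_ac)
  also have "\<dots> = ?P * (1 / (real J - real ?n)) *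
      ((\<Prod>j=1..J. (1 / lam j) ^ ?k' j) * lam i) * (1 / nu) ^ m"
    unfolding removed_order demand ..
  also have "\<dots> = product_form J lam nu ?k' * lam i"
    unfolding product_form_def stock k'_J prod.lessThan_Suc by (simp only: mult_ac)
  finally show ?thesis .
qed

theorem proposition6:
  fixes J :: nat and b :: "nat \<Rightarrow> nat" and lam :: "nat \<Rightarrow> real" and nu :: real
    and \<theta> :: "(nat \<Rightarrow> nat) \<Rightarrow> real"
  assumes "J > 1"
    and "\<And>j. j \<in> {1..J} \<Longrightarrow> lam j > 0"
    and "nu > 0"
    and "\<And>j. j \<in> {1..J} \<Longrightarrow> b j = 1"
  shows "positive_stationary_measure (state_space J b) (q_red J b lam nu) \<theta> \<longleftrightarrow>
    (\<exists>c>0. \<forall>k\<in>state_space J b.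
       \<theta> k = c * ((\<Prod>l<(\<Sum>j=1..J. k j). 1 / (real J - real l)) *
                  (\<Prod>j=1..J. (1 / lam j) ^ k j) *
                  (1 / nu) ^ k (Suc J)))"
  unfolding product_form_def[symmetric]
proof (rule positive_stationary_measure_reversible_iff[where r = "full_state J b"])
  show "finite (state_space J b)" by (rule finite_state_space)
  show "full_state J b \<in> state_space J b" by (rule full_state_in_state_space)
next
  fix k k' assume "k \<in> state_space J b" "k' \<in> state_space J b" "k \<noteq> k'"
  then show "q_red J b lam nu k k' \<ge> 0"
    using offdiag_rate_nonneg[OF assms(2,3)] by (simp add: q_red_def)
  show "product_form J lam nu k * q_red J b lam nu k k' =
      product_form J lam nu k' * q_red J b lam nu k' k"
    by (rule q_red_detailed_balance) (fact | rule product_form_balance[OF assms(4) _ _ _ assms(2,3)])+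
next
  fix k assume k: "k \<in> state_space J b"
  show "(\<Sum>k'\<in>state_space J b. q_red J b lam nu k k') = 0"
    by (rule q_red_row_sum[OF k])
  show "product_form J lam nu k > 0"
    by (rule product_form_pos[OF assms(4) k assms(2,3)])
  show "(k, full_state J b) \<in> {(k, k'). k \<in> state_space J b \<and> k' \<in> state_space J b \<and>
      q_red J b lam nu k k' > 0}\<^sup>*"
    by (rule full_state_reachable[OF k assms(2,3)])
qed

end
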